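(* Let $p$ be an odd prime and let $k \geq 1$ be an integer. Then: (i) $g_{p^k}(0) = (p^k - p^{k-1})^3$; (ii) $g_{p^k}(1) = p^{3(k-1)}(p-1)(p^2+1)$; (iii) $g_{2^k}(0) = 0$; (iv) $g_{2^k}(1) = 6 \cdot 8^{k-1}$.
   Context: For a positive integer $n$, let $\mathbb{Z}_n = \mathbb{Z}/n\mathbb{Z}$ be the ring of integers modulo $n$, and let $GL_2(\mathbb{Z}_n)$ be the group of units of the ring $M_2(\mathbb{Z}_n)$ of $2\times 2$ matrices over $\mathbb{Z}_n$. The permanent of $A = \begin{bmatrix} a & b \\ c & d \end{bmatrix} \in M_2(\mathbb{Z}_n)$ is $\mathrm{perm}(A) = ad+bc \in \mathbb{Z}_n$. For an integer $x$, $g_n(x)$ denotes the number of matrices $A \in GL_2(\mathbb{Z}_n)$ with $\mathrm{perm}(A) \equiv x \pmod n$. *)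

theory Defs
  imports "HOL-Number_Theory.Number_Theory"
begin

datatype 'a mat2 = Mat2 (e11: 'a) (e12: 'a) (e21: 'a) (e22: 'a)

definition mat2_ring :: "('a, 'm) ring_scheme \<Rightarrow> 'a mat2 ring"
  where "mat2_ring R =
    \<lparr>carrier = {A. e11 A \<in> carrier R \<and> e12 A \<in> carrier R \<and> e21 A \<in> carrier R \<and> e22 A \<in> carrier R},
     monoid.mult = (\<lambda>A B. Mat2
       (e11 A \<otimes>\<^bsub>R\<^esub> e11 B \<oplus>\<^bsub>R\<^esub> e12 A \<otimes>\<^bsub>R\<^esub> e21 B) (e11 A \<otimes>\<^bsub>R\<^esub> e12 B \<oplus>\<^bsub>R\<^esub> e12 A \<otimes>\<^bsub>R\<^esub> e22 B)
       (e21 A \<otimes>\<^bsub>R\<^esub> e11 B \<oplus>\<^bsub>R\<^esub> e22 A \<otimes>\<^bsub>R\<^esub> e21 B) (e21 A \<otimes>\<^bsub>R\<^esub> e12 B \<oplus>\<^bsub>R\<^esub> e22 A \<otimes>\<^bsub>R\<^esub> e22 B)),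
     one = Mat2 \<one>\<^bsub>R\<^esub> \<zero>\<^bsub>R\<^esub> \<zero>\<^bsub>R\<^esub> \<one>\<^bsub>R\<^esub>,
     zero = Mat2 \<zero>\<^bsub>R\<^esub> \<zero>\<^bsub>R\<^esub> \<zero>\<^bsub>R\<^esub> \<zero>\<^bsub>R\<^esub>,
     add = (\<lambda>A B. Mat2 (e11 A \<oplus>\<^bsub>R\<^esub> e11 B) (e12 A \<oplus>\<^bsub>R\<^esub> e12 B) (e21 A \<oplus>\<^bsub>R\<^esub> e21 B) (e22 A \<oplus>\<^bsub>R\<^esub> e22 B))\<rparr>"

lemma ring_mat2_ring:
  assumes "ring R"
  shows "ring (mat2_ring R)"
proof -
  interpret ring R by fact
  show ?thesis
  proof (intro ringI abelian_groupI monoidI)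
    fix A assume "A \<in> carrier (mat2_ring R)"
    then show "\<exists>B\<in>carrier (mat2_ring R). B \<oplus>\<^bsub>mat2_ring R\<^esub> A = \<zero>\<^bsub>mat2_ring R\<^esub>"
      by (intro bexI[of _ "map_mat2 (\<lambda>x. \<ominus>\<^bsub>R\<^esub> x) A"]; cases A) (auto simp: mat2_ring_def l_neg)
  qed (auto simp: mat2_ring_def mat2.set_sel mat2.expand l_distr r_distr m_assoc a_ac)
qed

definition GL2 :: "('a, 'm) ring_scheme \<Rightarrow> 'a mat2 monoid"
  where "GL2 R = units_of (mat2_ring R)"

definition perm2 :: "('a, 'm) ring_scheme \<Rightarrow> 'a mat2 \<Rightarrow> 'a"
  where "perm2 R A = e11 A \<otimes>\<^bsub>R\<^esub> e22 A \<oplus>\<^bsub>R\<^esub> e12 A \<otimes>\<^bsub>R\<^esub> e21 A"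

(* The library constant residue_ring m is the ring Z/mZ only for m > 1: its one is the integer 1, which
   lies outside the carrier {0} when m = 1. So g n is meant for n > 1. *)
definition g :: "nat \<Rightarrow> int \<Rightarrow> nat"
  where "g n x = card {A \<in> carrier (GL2 (residue_ring (int n))).
                        [perm2 (residue_ring (int n)) A = x] (mod int n)}"

end

theory Submission
  imports Defs
begin

text \<open>
  Modulo \<open>N = p\<^sup>k\<close>, split the matrices with \<open>ad + bc = x\<close> and \<open>ad - bc\<close> a unit according to whether
  \<open>a\<close> is a unit. If it is, then \<open>d\<close> is determined by \<open>a, b, c\<close>, and the determinant is \<open>x - 2bc\<close>. If it
  is not, then the determinant is \<open>-bc = -x\<close> modulo \<open>p\<close>; so there are no such matrices for \<open>x = 0\<close>,
  while for \<open>x = 1\<close> the entry \<open>b\<close> is a unit, \<open>c\<close> is determined by \<open>a, b, d\<close>, and nothing else is required.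
  This treats \<open>p = 2\<close> along with the odd primes.
\<close>

section \<open>Invertible matrices and the determinant\<close>

text \<open>The determinant is multiplicative, so an inverse of \<open>A\<close> makes it invertible
  modulo \<open>N\<close>; conversely, the adjugate divided by the determinant is a two-sided
  inverse.\<close>

lemma carrier_GL2_residue_ring:
  fixes N :: int
  assumes "N > 1"
  shows "carrier (GL2 (residue_ring N)) =
    {A. {e11 A, e12 A, e21 A, e22 A} \<subseteq> {0..<N} \<and> coprime (e11 A * e22 A - e12 A * e21 A) N}"
    (is "?L = ?R")
proof -
  have carr: "A \<in> carrier (mat2_ring (residue_ring N)) \<longleftrightarrow>
      {e11 A, e12 A, e21 A, e22 A} \<subseteq> {0..<N}" for A
    by (auto simp: mat2_ring_def residue_ring_def)
  have mult: "A \<otimes>\<^bsub>mat2_ring (residue_ring N)\<^esub> B = Mat2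
      ((e11 A * e11 B + e12 A * e21 B) mod N) ((e11 A * e12 B + e12 A * e22 B) mod N)
      ((e21 A * e11 B + e22 A * e21 B) mod N) ((e21 A * e12 B + e22 A * e22 B) mod N)" for A B
    by (simp add: mat2_ring_def residue_ring_def mod_simps)
  have one: "\<one>\<^bsub>mat2_ring (residue_ring N)\<^esub> = Mat2 1 0 0 1"
    by (simp add: mat2_ring_def residue_ring_def)
  \<comment> \<open>These strip the inner reductions from the entries of the inverse constructed
    below, once for each side on which it multiplies.\<close>
  have mod_lin: "(a * (x mod N) + b * (y mod N)) mod N = (a * x + b * y) mod N"
    "((x mod N) * a + (y mod N) * b) mod N = (x * a + y * b) mod N" for a b x y
    by (metis mod_add_eq mod_mult_right_eq, metis mod_add_eq mod_mult_left_eq)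
  show ?thesis
  proof (intro equalityI subsetI)
    fix A assume "A \<in> ?L"
    then obtain B where A: "{e11 A, e12 A, e21 A, e22 A} \<subseteq> {0..<N}"
      and AB: "A \<otimes>\<^bsub>mat2_ring (residue_ring N)\<^esub> B = Mat2 1 0 0 1"
      by (auto simp: GL2_def units_of_def Units_def carr one)
    have m: "[e11 A * e11 B + e12 A * e21 B = 1] (mod N)"
      "[e11 A * e12 B + e12 A * e22 B = 0] (mod N)"
      "[e21 A * e11 B + e22 A * e21 B = 0] (mod N)"
      "[e21 A * e12 B + e22 A * e22 B = 1] (mod N)"
      using AB assms by (simp_all add: mult cong_def)
    \<comment> \<open>The left side is the determinant of the product, and it expands to the product
      of the two determinants.\<close>
    have "[(e11 A * e11 B + e12 A * e21 B) * (e21 A * e12 B + e22 A * e22 B)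
        - (e11 A * e12 B + e12 A * e22 B) * (e21 A * e11 B + e22 A * e21 B) = 1 * 1 - 0 * 0] (mod N)"
      by (intro cong_diff cong_mult m)
    then have "[(e11 A * e22 A - e12 A * e21 A) * (e11 B * e22 B - e12 B * e21 B) = 1] (mod N)"
      by (simp add: algebra_simps)
    then have "coprime (e11 A * e22 A - e12 A * e21 A) N"
      by (metis coprime_iff_invertible_int)
    with A show "A \<in> ?R" by simp
  next
    fix A assume A: "A \<in> ?R"
    then obtain u where u: "[(e11 A * e22 A - e12 A * e21 A) * u = 1] (mod N)"
      by (auto simp: coprime_iff_invertible_int)
    \<comment> \<open>The adjugate of \<open>A\<close>, scaled by an inverse \<open>u\<close> of the
      determinant.\<close>
    define B where "B = Mat2 ((e22 A * u) mod N) ((- e12 A * u) mod N)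
      ((- e21 A * u) mod N) ((e11 A * u) mod N)"
    have "B \<in> carrier (mat2_ring (residue_ring N))"
      using assms by (simp add: carr B_def)
    moreover have "A \<otimes>\<^bsub>mat2_ring (residue_ring N)\<^esub> B = Mat2 1 0 0 1"
      "B \<otimes>\<^bsub>mat2_ring (residue_ring N)\<^esub> A = Mat2 1 0 0 1"
      using u assms by (simp_all add: mult B_def mod_lin cong_def) (simp_all add: algebra_simps)
    ultimately show "A \<in> ?L"
      using A by (auto simp: GL2_def units_of_def Units_def carr one)
  qed
qed

text \<open>For \<open>N\<close> a power of the prime \<open>P\<close>, this is the set counted by
  \<open>g\<close>, with residues as integers in \<open>{0..<N}\<close> and invertibility tested
  modulo \<open>P\<close> alone.\<close>

definition perm_units :: "int \<Rightarrow> int \<Rightarrow> int \<Rightarrow> int mat2 set" where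
  "perm_units P N x = {A. {e11 A, e12 A, e21 A, e22 A} \<subseteq> {0..<N} \<and>
     \<not> P dvd e11 A * e22 A - e12 A * e21 A \<and> [e11 A * e22 A + e12 A * e21 A = x] (mod N)}"

lemma coprime_prime_power_iff:
  fixes p k :: nat and y :: int
  assumes "prime p" and "k \<ge> 1"
  shows "coprime y (int p ^ k) \<longleftrightarrow> \<not> int p dvd y"
proof -
  have p: "prime (int p)"
    using assms by simp
  then have "coprime y (int p) \<longleftrightarrow> \<not> int p dvd y"
    by (metis coprime_commute coprime_common_divisor dvd_refl not_prime_unit prime_imp_coprime)
  then show ?thesis
    using assms by simp
qed

lemma g_prime_power:
  fixes p k :: nat
  assumes "prime p" and "k \<ge> 1"
  shows "g (p ^ k) x = card (perm_units (int p) (int p ^ k) x)"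
proof -
  \<comment> \<open>A modulus above 1 is what makes \<open>residue_ring\<close> have its one in the
    carrier.\<close>
  have "p ^ k > 1"
    using assms by (metis One_nat_def Suc_le_lessD one_less_power prime_gt_1_nat)
  then have N: "int p ^ k > 1"
    by (metis of_nat_1 of_nat_less_iff of_nat_power)
  show ?thesis
    unfolding g_def perm_units_def of_nat_power carrier_GL2_residue_ring[OF N]
      coprime_prime_power_iff[OF assms]
    by (intro arg_cong[where f = card]) (auto simp: perm2_def residue_ring_def cong_def mod_simps)
qed

section \<open>Linear congruences and residue classes in an interval\<close>

lemma cong_solve_unique_interval_int:
  fixes a N y :: int
  assumes "coprime a N" and "N > 0"
  shows "\<exists>!z. z \<in> {0..<N} \<and> [a * z = y] (mod N)"
proof -
  obtain u where u: "[a * u = 1] (mod N)"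
    using assms coprime_iff_invertible_int by blast
  have "[a * (u * y mod N) = y] (mod N)"
    using cong_scalar_right[OF u, of y] by (simp add: cong_def mod_simps mult.assoc)
  moreover have "z = z'" if "z \<in> {0..<N}" "z' \<in> {0..<N}"
    "[a * z = y] (mod N)" "[a * z' = y] (mod N)" for z z'
  proof -
    have "[a * z = a * z'] (mod N)"
      using that cong_sym cong_trans by blast
    then have "[z = z'] (mod N)"
      using assms by (simp add: cong_mult_lcancel)
    then show ?thesis
      using that by (auto intro: cong_less_imp_eq_int)
  qed
  ultimately show ?thesis
    using assms by (intro ex1I[of _ "u * y mod N"]) auto
qed

text \<open>The class of \<open>r\<close> meets the interval exactly in the points
  \<open>r mod P + P * j\<close> with \<open>j\<close> in \<open>{0..<m}\<close>; division by
  \<open>P\<close> recovers \<open>j\<close>.\<close>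

lemma card_cong_interval_int:
  fixes P m r :: int
  assumes "P > 0" and "m \<ge> 0"
  shows "card {c \<in> {0..<P * m}. [c = r] (mod P)} = nat m"
proof -
  have "bij_betw (\<lambda>j. r mod P + P * j) {0..<m} {c \<in> {0..<P * m}. [c = r] (mod P)}"
  proof (rule bij_betw_byWitness[where f' = "\<lambda>c. c div P"])
    show "(\<lambda>j. r mod P + P * j) ` {0..<m} \<subseteq> {c \<in> {0..<P * m}. [c = r] (mod P)}"
    proof clarsimp
      fix j assume j: "0 \<le> j" "j < m"
      have "r mod P + P * j < P * (j + 1)"
        using assms by (simp add: algebra_simps)
      also have "\<dots> \<le> P * m"
        using j assms by (intro mult_left_mono) auto
      finally show "0 \<le> r mod P + P * j \<and> r mod P + P * j < P * m \<and> [r mod P + P * j = r] (mod P)"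
        using j assms by (simp add: cong_def)
    qed
    have div_less: "c div P < m" if "c < P * m" for c
    proof -
      have "P * (c div P) \<le> c"
        using assms by (metis le_add_same_cancel1 mult_div_mod_eq pos_mod_sign)
      then have "P * (c div P) < P * m"
        using that by linarith
      then show ?thesis
        using assms by simp
    qed
    show "(\<lambda>c. c div P) ` {c \<in> {0..<P * m}. [c = r] (mod P)} \<subseteq> {0..<m}"
      using assms by (auto simp: pos_imp_zdiv_nonneg_iff div_less)
    show "\<forall>c \<in> {c \<in> {0..<P * m}. [c = r] (mod P)}. r mod P + P * (c div P) = c"
      by (auto simp: cong_def) (metis mod_mult_div_eq)
  qed (use assms in auto)
  then show ?thesis
    using bij_betw_same_card by fastforce
qed

section \<open>Counting modulo a prime power\<close>

text \<open>The model is \<open>P = p\<close>, \<open>m = p ^ (k - 1)\<close>,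
  \<open>N = p ^ k\<close>. The last assumption makes \<open>P\<close> the only prime divisor of
  \<open>N\<close>, so the counts can be done without exponents.\<close>

locale prime_power_modulus =
  fixes P m N :: int
  assumes prime: "prime P" and pos: "m > 0" and N: "N = P * m"
    and coprime_iff: "\<And>y. coprime y N \<longleftrightarrow> \<not> P dvd y"
begin

lemma N_pos: "N > 0"
  using prime pos N prime_gt_0_int by simp

lemma P_dvd_N: "P dvd N"
  by (simp add: N)

lemma card_nonunits: "int (card {a \<in> {0..<N}. P dvd a}) = m"
  using card_cong_interval_int[of P m 0] prime_gt_0_int[OF prime] pos N
  by (simp add: cong_0_iff)

lemma card_units: "int (card {a \<in> {0..<N}. \<not> P dvd a}) = N - m"
proof -
  have "card {0..<N} = card {a \<in> {0..<N}. P dvd a} + card {a \<in> {0..<N}. \<not> P dvd a}"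
    using card_Int_Diff[of "{0..<N}" "{a. P dvd a}"] by (simp add: Int_def set_diff_eq)
  then show ?thesis
    using card_nonunits N_pos by simp
qed

text \<open>Forgetting \<open>e22\<close> is a bijection, since \<open>d\<close> is the unique
  solution of \<open>a * d = x - b * c\<close>. The condition on the determinant then constrains
  only \<open>b\<close> and \<open>c\<close>, so the unit \<open>a\<close> splits off as a
  factor.\<close>

lemma card_unit_corner:
  "card {A \<in> perm_units P N x. \<not> P dvd e11 A} =
   card {a \<in> {0..<N}. \<not> P dvd a} * card {(b, c). b \<in> {0..<N} \<and> c \<in> {0..<N} \<and> \<not> P dvd x - 2 * b * c}"
    (is "card ?S = card ?U * card ?V")
proof -
  have det: "P dvd a * d - b * c \<longleftrightarrow> P dvd x - 2 * b * c" if "[a * d + b * c = x] (mod N)" for a b c d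
  proof -
    have "P dvd a * d + b * c - x"
      using that P_dvd_N by (meson cong_iff_dvd_diff dvd_trans)
    moreover have "a * d - b * c = (a * d + b * c - x) + (x - 2 * b * c)"
      by simp
    ultimately show ?thesis
      by (metis dvd_add_right_iff)
  qed
  have ex1: "\<exists>!d. d \<in> {0..<N} \<and> [a * d + b * c = x] (mod N)" if "\<not> P dvd a" for a b c
  proof -
    have "[a * d + b * c = x] (mod N) \<longleftrightarrow> [a * d = x - b * c] (mod N)" for d
      by (simp add: cong_iff_dvd_diff algebra_simps)
    then show ?thesis
      using cong_solve_unique_interval_int[of a N "x - b * c"] that N_pos coprime_iff by simp
  qed
  have "bij_betw (\<lambda>A. (e11 A, e12 A, e21 A)) ?S (?U \<times> ?V)"
    unfolding bij_betw_def
  proof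
    show "inj_on (\<lambda>A. (e11 A, e12 A, e21 A)) ?S"
      using ex1 by (auto simp: inj_on_def perm_units_def intro!: mat2.expand) metis+
    show "(\<lambda>A. (e11 A, e12 A, e21 A)) ` ?S = ?U \<times> ?V"
    proof (intro equalityI subsetI)
      fix t assume "t \<in> ?U \<times> ?V"
      then obtain a b c where t: "t = (a, b, c)" and abc: "a \<in> {0..<N}" "b \<in> {0..<N}" "c \<in> {0..<N}"
        "\<not> P dvd a" "\<not> P dvd x - 2 * b * c"
        by auto
      then obtain d where d: "d \<in> {0..<N}" "[a * d + b * c = x] (mod N)"
        using ex1 by blast
      have "Mat2 a b c d \<in> ?S"
        using abc d det[OF d(2)] by (simp add: perm_units_def)
      then show "t \<in> (\<lambda>A. (e11 A, e12 A, e21 A)) ` ?S"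
        by (auto simp: t intro: rev_image_eqI)
    qed (auto simp: perm_units_def det)
  qed
  then show ?thesis
    by (simp add: bij_betw_same_card card_cartesian_product)
qed

text \<open>Forgetting \<open>e21\<close> is a bijection: modulo \<open>P\<close> the permanent
  condition reads \<open>b * c = 1\<close>, which makes \<open>b\<close> a unit and the determinant
  nonzero. Hence \<open>d\<close> is free and \<open>c\<close> is determined.\<close>

lemma card_nonunit_corner_1:
  "card {A \<in> perm_units P N 1. P dvd e11 A} =
   card {a \<in> {0..<N}. P dvd a} * (card {b \<in> {0..<N}. \<not> P dvd b} * card {0..<N})"
    (is "card ?S = card ?I * (card ?U * _)")
proof -
  have unit: "\<not> P dvd b \<and> \<not> P dvd a * d - b * c"
    if a: "P dvd a" and perm: "[a * d + b * c = 1] (mod N)" for a b c d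
  proof -
    have "P dvd a * d + b * c - 1"
      using perm P_dvd_N by (meson cong_iff_dvd_diff dvd_trans)
    moreover have "b * c = (a * d + b * c - 1) + 1 - a * d"
      by simp
    ultimately have "\<not> P dvd b * c"
      using a prime by (metis add_diff_cancel_left' dvd_add_right_iff dvd_diff dvd_mult2
          not_prime_unit diff_add_cancel)
    then show ?thesis
      using a by (metis dvd_diff_right_iff dvd_mult2)
  qed
  have ex1: "\<exists>!c. c \<in> {0..<N} \<and> [a * d + b * c = 1] (mod N)" if "\<not> P dvd b" for a b d
  proof -
    have "[a * d + b * c = 1] (mod N) \<longleftrightarrow> [b * c = 1 - a * d] (mod N)" for c
      by (simp add: cong_iff_dvd_diff algebra_simps)
    then show ?thesis
      using cong_solve_unique_interval_int[of b N "1 - a * d"] that N_pos coprime_iff by simp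
  qed
  have "bij_betw (\<lambda>A. (e11 A, e12 A, e22 A)) ?S (?I \<times> ?U \<times> {0..<N})"
    unfolding bij_betw_def
  proof
    show "inj_on (\<lambda>A. (e11 A, e12 A, e22 A)) ?S"
    proof (rule inj_onI)
      fix A B assume AB: "A \<in> ?S" "B \<in> ?S"
        and eq: "(e11 A, e12 A, e22 A) = (e11 B, e12 B, e22 B)"
      then have "\<not> P dvd e12 A"
        using unit[of "e11 A" "e22 A" "e12 A" "e21 A"] by (simp add: perm_units_def)
      then have "e21 A = e21 B"
        using AB eq ex1[of "e12 A" "e11 A" "e22 A"] by (auto simp: perm_units_def)
      with eq show "A = B"
        by (auto intro: mat2.expand)
    qed
    show "(\<lambda>A. (e11 A, e12 A, e22 A)) ` ?S = ?I \<times> ?U \<times> {0..<N}"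
    proof (intro equalityI subsetI)
      fix t assume "t \<in> ?I \<times> ?U \<times> {0..<N}"
      then obtain a b d where t: "t = (a, b, d)" and abd: "a \<in> {0..<N}" "b \<in> {0..<N}" "d \<in> {0..<N}"
        "P dvd a" "\<not> P dvd b"
        by auto
      then obtain c where c: "c \<in> {0..<N}" "[a * d + b * c = 1] (mod N)"
        using ex1 by blast
      have "Mat2 a b c d \<in> ?S"
        using abd c unit[OF abd(4) c(2)] by (simp add: perm_units_def)
      then show "t \<in> (\<lambda>A. (e11 A, e12 A, e22 A)) ` ?S"
        by (auto simp: t intro: rev_image_eqI)
    qed (auto simp: perm_units_def dest: unit)
  qed
  then show ?thesis
    by (simp add: bij_betw_same_card card_cartesian_product)
qed

text \<open>If \<open>P\<close> divides both \<open>a\<close> and the permanent, it divides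
  \<open>b * c\<close> and hence the determinant.\<close>

lemma nonunit_corner_0: "{A \<in> perm_units P N 0. P dvd e11 A} = {}"
proof -
  have "P dvd a * d - b * c" if "P dvd a" "[a * d + b * c = 0] (mod N)" for a b c d
  proof -
    have "P dvd a * d + b * c"
      using that P_dvd_N by (meson cong_0_iff dvd_trans)
    then show ?thesis
      using that by (simp add: dvd_add_right_iff)
  qed
  then show ?thesis
    by (auto simp: perm_units_def)
qed

lemma finite_perm_units: "finite (perm_units P N x)"
proof (rule finite_subset)
  show "perm_units P N x \<subseteq>
      (\<lambda>(a, b, c, d). Mat2 a b c d) ` ({0..<N} \<times> {0..<N} \<times> {0..<N} \<times> {0..<N})"
  proof
    fix A assume "A \<in> perm_units P N x"
    then show "A \<in> (\<lambda>(a, b, c, d). Mat2 a b c d) ` ({0..<N} \<times> {0..<N} \<times> {0..<N} \<times> {0..<N})"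
      by (intro image_eqI[of _ _ "(e11 A, e12 A, e21 A, e22 A)"]) (auto simp: perm_units_def)
  qed
qed simp

lemma card_perm_units_split:
  "card (perm_units P N x) = card {A \<in> perm_units P N x. \<not> P dvd e11 A}
     + card {A \<in> perm_units P N x. P dvd e11 A}"
  using card_Int_Diff[OF finite_perm_units[of x], of "{A. P dvd e11 A}"]
  by (simp add: Int_def set_diff_eq)

section \<open>Evaluation at 0 and 1\<close>

text \<open>As 2 is a unit modulo \<open>P\<close>, the condition on \<open>- 2 * b * c\<close> says
  that \<open>b\<close> and \<open>c\<close> are both units. So \<open>a\<close>, \<open>b\<close>,
  \<open>c\<close> are three independent units.\<close>

lemma card_perm_units_0:
  assumes "odd P"
  shows "int (card (perm_units P N 0)) = (N - m) ^ 3"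
proof -
  have "\<not> P dvd 2"
    using assms primes_dvd_imp_eq[OF prime, of 2] by auto
  then have "{(b, c). b \<in> {0..<N} \<and> c \<in> {0..<N} \<and> \<not> P dvd 0 - 2 * b * c}
      = {b \<in> {0..<N}. \<not> P dvd b} \<times> {c \<in> {0..<N}. \<not> P dvd c}"
    using prime by (auto simp: prime_dvd_mult_iff)
  then show ?thesis
    by (simp add: card_perm_units_split card_unit_corner nonunit_corner_0 card_cartesian_product
        card_units power3_eq_cube del: diff_0 atLeastLessThan_iff)
qed

lemma perm_units_0_even:
  assumes "P = 2"
  shows "perm_units P N 0 = {}"
proof -
  have "{(b, c). b \<in> {0..<N} \<and> c \<in> {0..<N} \<and> \<not> P dvd 0 - 2 * b * c} = {}"
    using assms by auto
  then have "card (perm_units P N 0) = 0"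
    by (simp only: card_perm_units_split card_unit_corner nonunit_corner_0) simp
  then show ?thesis
    by (simp add: finite_perm_units)
qed

lemma card_perm_units_1_aux:
  "int (card (perm_units P N 1)) = (N - m) *
     (int (card {(b, c). b \<in> {0..<N} \<and> c \<in> {0..<N} \<and> \<not> P dvd 1 - 2 * b * c}) + m * N)"
  using N_pos by (simp add: card_perm_units_split card_unit_corner card_nonunit_corner_1
      card_units card_nonunits algebra_simps del: atLeastLessThan_iff)

text \<open>All \<open>N * N\<close> pairs qualify because \<open>1 - 2 * b * c\<close> is odd; with
  \<open>N = 2 * m\<close> the count is \<open>m * (4 * m ^ 2 + 2 * m ^ 2)\<close>.\<close>

lemma card_perm_units_1_even:
  assumes "P = 2"
  shows "int (card (perm_units P N 1)) = 6 * m ^ 3"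
proof -
  have "{(b, c). b \<in> {0..<N} \<and> c \<in> {0..<N} \<and> \<not> P dvd 1 - 2 * b * c} = {0..<N} \<times> {0..<N}"
    using assms by auto
  then show ?thesis
    using N_pos
    by (simp add: card_perm_units_1_aux card_cartesian_product del: atLeastLessThan_iff)
      (simp add: N assms power3_eq_cube)
qed

text \<open>The pairs are counted by their complement \<open>?W\<close>, where
  \<open>2 * b * c\<close> is 1 modulo \<open>P\<close>: each unit \<open>b\<close> leaves one class
  of \<open>c\<close> modulo \<open>P\<close>, that is, \<open>m\<close> values.\<close>

lemma card_perm_units_1:
  assumes "odd P"
  shows "int (card (perm_units P N 1)) = m ^ 3 * (P - 1) * (P ^ 2 + 1)"
proof -
  let ?V = "{(b, c). b \<in> {0..<N} \<and> c \<in> {0..<N} \<and> \<not> P dvd 1 - 2 * b * c}"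
  let ?W = "SIGMA b:{b \<in> {0..<N}. \<not> P dvd b}. {c \<in> {0..<N}. P dvd 1 - 2 * b * c}"
  have two: "\<not> P dvd 2"
    using assms primes_dvd_imp_eq[OF prime, of 2] by auto
  have fibre: "card {c \<in> {0..<N}. P dvd 1 - 2 * b * c} = nat m" if "\<not> P dvd b" for b
  proof -
    have "coprime (2 * b) P"
      using two that prime by (metis coprime_commute prime_dvd_mult_iff prime_imp_coprime)
    then obtain r where r: "[2 * b * r = 1] (mod P)"
      by (auto simp: coprime_iff_invertible_int)
    have "P dvd 1 - 2 * b * c \<longleftrightarrow> [c = r] (mod P)" for c
    proof -
      have "P dvd 1 - 2 * b * c \<longleftrightarrow> [2 * b * c = 1] (mod P)"
        by (simp add: cong_iff_dvd_diff dvd_diff_commute)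
      also have "\<dots> \<longleftrightarrow> [2 * b * c = 2 * b * r] (mod P)"
        using r by (metis cong_sym cong_trans)
      also have "\<dots> \<longleftrightarrow> [c = r] (mod P)"
        using \<open>coprime (2 * b) P\<close> by (rule cong_mult_lcancel)
      finally show ?thesis .
    qed
    then show ?thesis
      using card_cong_interval_int[of P m r] prime_gt_0_int[OF prime] pos N by simp
  qed
  have W: "int (card ?W) = (N - m) * m"
    using fibre pos by (simp add: card_SigmaI card_units del: atLeastLessThan_iff)
  \<comment> \<open>Restricting \<open>?W\<close> to units \<open>b\<close> loses no pair of the
    complement, since otherwise \<open>P\<close> would divide 1.\<close>
  have "\<not> P dvd b" if "P dvd 1 - 2 * b * c" for b c
    using that prime by (metis diff_add_cancel dvd_add dvd_mult dvd_mult2 not_prime_unit)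
  then have "?V \<union> ?W = {0..<N} \<times> {0..<N}" and "?V \<inter> ?W = {}"
    by auto
  moreover have "finite ?V"
    by (rule finite_subset[of _ "{0..<N} \<times> {0..<N}"]) auto
  ultimately have "card ({0..<N} \<times> {0..<N}) = card ?V + card ?W"
    by (metis (no_types, lifting) card_Un_disjoint finite_Un finite_SigmaI finite_atLeastLessThan_int)
  then have V: "int (card ?V) = N * N - (N - m) * m"
    using N_pos W by (simp add: card_cartesian_product of_nat_eq_iff[where 'a = int, symmetric]
        del: of_nat_eq_iff atLeastLessThan_iff)
  show ?thesis
    unfolding card_perm_units_1_aux V by (simp add: N power3_eq_cube power2_eq_square algebra_simps)
qed

end

section \<open>Specialisation to powers of primes\<close>

lemma prime_power_modulus_nat:
  fixes p k :: nat
  assumes "prime p" and "k \<ge> 1"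
  shows "prime_power_modulus (int p) (int p ^ (k - 1)) (int p ^ k)"
proof
  show "prime (int p)" "int p ^ (k - 1) > 0"
    using assms by (simp_all add: prime_gt_0_nat)
  \<comment> \<open>Truncated subtraction matters here: at \<open>k = 0\<close> the right side would
    be \<open>p\<close>, not 1.\<close>
  show "int p ^ k = int p * int p ^ (k - 1)"
    using assms by (cases k) auto
  show "coprime y (int p ^ k) \<longleftrightarrow> \<not> int p dvd y" for y
    using assms by (rule coprime_prime_power_iff)
qed

theorem corollary2p6:
  fixes p k :: nat
  assumes "prime p" and "odd p" and "k \<ge> 1"
  shows "int (g (p ^ k) 0) = (int p ^ k - int p ^ (k - 1)) ^ 3 \<and>
         int (g (p ^ k) 1) = int p ^ (3 * (k - 1)) * (int p - 1) * (int p ^ 2 + 1) \<and>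
         g (2 ^ k) 0 = 0 \<and>
         g (2 ^ k) 1 = 6 * 8 ^ (k - 1)"
proof -
  interpret p: prime_power_modulus "int p" "int p ^ (k - 1)" "int p ^ k"
    by (rule prime_power_modulus_nat) fact+
  \<comment> \<open>The even modulus is a second instance of the same counts, with
    \<open>P = 2\<close> and the same exponent \<open>k\<close>.\<close>
  interpret two: prime_power_modulus "2" "2 ^ (k - 1)" "2 ^ k"
    using prime_power_modulus_nat[of 2 k] assms(3) by simp
  have g2: "g (2 ^ k) x = card (perm_units 2 (2 ^ k) x)" for x
    using g_prime_power[of 2 k] assms(3) by simp
  have "int (g (2 ^ k) 1) = 6 * (2 ^ (k - 1)) ^ 3"
    by (simp add: g2 two.card_perm_units_1_even)
  also have "\<dots> = int (6 * 8 ^ (k - 1))"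
    by (simp add: power_mult[symmetric] mult.commute[of _ 3]) (simp add: power_mult)
  finally have "g (2 ^ k) 1 = 6 * 8 ^ (k - 1)"
    by (simp only: of_nat_eq_iff)
  then show ?thesis
    using assms by (simp add: g_prime_power p.card_perm_units_0 p.card_perm_units_1 g2
        two.perm_units_0_even power_mult[symmetric] mult.commute)
qed

end
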